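(* Let $n\ge 1$, let $f_i:\mathbb{R}\to\mathbb{R}$ be continuous for each $i\in\{1,\dots,n\}$, and let $a_{ij}\ge 0$, $i,j\in\{1,\dots,n\}$, be interconnection weights. For $\gamma>0$ consider the networked system $$\dot x_i = f_i(x_i)-\gamma\sum_{j=1}^n a_{ij}(x_i-x_j),\qquad x_i\in\mathbb{R},\quad i\in\{1,\dots,n\},\qquad (\Sigma_\gamma)$$ with state $x=[x_1\ \cdots\ x_n]^\top\in\mathbb{R}^n$. Assume: (1) the directed graph $\mathcal{G}$ with node set $\{1,\dots,n\}$, having a directed edge from node $j$ to node $i$ if and only if $a_{ij}>0$, is connected and contains a directed spanning tree; (2) for each $i\in\{1,\dots,n\}$, the system $\dot x_i=f_i(x_i)+u_i$ with input $u_i\in\mathbb{R}$ and output $x_i$ is state strictly semi-passive in the sense given in the context. Then the solutions of $(\Sigma_\gamma)$ are globally bounded, uniformly in $\gamma$: for every $r_o>0$ and every $\gamma_o>0$ there exists $R=R(r_o,\gamma_o)\ge r_o$ such that, for all $\gamma\ge\gamma_o$, every maximal forward solution $t\mapsto x(t)$ of $(\Sigma_\gamma)$ starting at time $0$ with $|x(0)|\le r_o$ is defined for all $t\ge 0$ and satisfies $$|x(t)|\le R\qquad\forall\, t\ge 0.$$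
   Context: $|\cdot|$ denotes the Euclidean norm. A directed spanning tree in $\mathcal{G}$ is a directed tree, made of edges of $\mathcal{G}$, with a root node from which every other node is reachable by a directed path. A class $\mathcal{K}_\infty$ function $\alpha:\mathbb{R}_{\ge0}\to\mathbb{R}_{\ge0}$ is a continuous, strictly increasing, unbounded function with $\alpha(0)=0$. State strict semi-passivity of $\dot x_i=f_i(x_i)+u_i$ (map $u_i\mapsto x_i$): there exist a continuously differentiable storage function $V_i:\mathbb{R}\to\mathbb{R}_{\ge0}$, a class $\mathcal{K}_\infty$ function $\underline{\alpha}_i$, a constant $\rho_i>0$, a continuous function $H_i:\mathbb{R}\to\mathbb{R}$, and a continuous function $\psi_i:\mathbb{R}_{\ge0}\to\mathbb{R}_{>0}$ such that, for all $x_i\in\mathbb{R}$ and all $u_i\in\mathbb{R}$, $$\underline{\alpha}_i(|x_i|)\le V_i(x_i),\qquad \dot V_i(x_i):=V_i'(x_i)\,\bigl(f_i(x_i)+u_i\bigr)\le 2u_ix_i-H_i(x_i),$$ and $H_i(x_i)\ge\psi_i(|x_i|)$ for all $|x_i|\ge\rho_i$. The functions $f_i$ are only assumed continuous, so solutions (continuously differentiable functions satisfying the differential equation) need not be unique; the conclusion concerns all solutions. The constant $R$ may depend on the fixed data $(f_i)$, $(a_{ij})$ but not on $\gamma\geq\gamma_o$. *)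

theory Defs
  imports "HOL-Analysis.Analysis" "Graph_Theory.Digraph_Component"
begin

text \<open>Functions on the nonnegative reals are represented by functions on all reals, of which only
  the restriction to \<open>{0..}\<close> matters. Values in \<open>{0..}\<close> follow from \<open>\<alpha> 0 = 0\<close> and monotonicity.\<close>

definition class_K_infinity :: "(real \<Rightarrow> real) \<Rightarrow> bool" where
  "class_K_infinity \<alpha> \<longleftrightarrow>
     continuous_on {0..} \<alpha> \<and> strict_mono_on {0..} \<alpha> \<and> \<not> bounded (\<alpha> ` {0..}) \<and> \<alpha> 0 = 0"

definition state_strictly_semi_passive :: "(real \<Rightarrow> real) \<Rightarrow> bool" where
  "state_strictly_semi_passive f \<longleftrightarrow>
     (\<exists>V \<alpha> \<rho> H \<psi>.
        V C1_differentiable_on UNIV \<and> (\<forall>x. V x \<ge> 0) \<and>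
        class_K_infinity \<alpha> \<and>
        \<rho> > 0 \<and>
        continuous_on UNIV H \<and>
        continuous_on {0..} \<psi> \<and> (\<forall>s\<ge>0. \<psi> s > 0) \<and>
        (\<forall>x u. \<alpha> \<bar>x\<bar> \<le> V x \<and> deriv V x * (f x + u) \<le> 2 * u * x - H x) \<and>
        (\<forall>x. \<bar>x\<bar> \<ge> \<rho> \<longrightarrow> H x \<ge> \<psi> \<bar>x\<bar>))"

definition interconnection_graph :: "('n \<Rightarrow> 'n \<Rightarrow> real) \<Rightarrow> ('n, 'n \<times> 'n) pre_digraph" where
  "interconnection_graph a =
     \<lparr> verts = UNIV, arcs = {(j, i). a i j > 0}, tail = fst, head = snd \<rparr>"

text \<open>The library's \<^const>\<open>tree\<close> only excludes directed cycles, so a directed acyclic graph in which a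
  node has several predecessors would qualify. A directed tree with a root is an arborescence:
  there is exactly one directed walk from the root to each node.\<close>

definition directed_tree :: "('a, 'b) pre_digraph \<Rightarrow> 'a \<Rightarrow> bool" where
  "directed_tree T r \<longleftrightarrow>
     wf_digraph T \<and> r \<in> verts T \<and> (\<forall>v\<in>verts T. \<exists>!p. pre_digraph.awalk T r p v)"

definition has_directed_spanning_tree :: "('a, 'b) pre_digraph \<Rightarrow> bool" where
  "has_directed_spanning_tree G \<longleftrightarrow> (\<exists>T r. spanning T G \<and> directed_tree T r)"

definition network_field ::
  "('n::finite \<Rightarrow> real \<Rightarrow> real) \<Rightarrow> ('n \<Rightarrow> 'n \<Rightarrow> real) \<Rightarrow> real \<Rightarrow> real ^ 'n \<Rightarrow> real ^ 'n" where
  "network_field f a \<gamma> x =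
     (\<chi> i. f i (x $ i) - \<gamma> * (\<Sum>j\<in>UNIV. a i j * (x $ i - x $ j)))"

text \<open>A forward solution is a function together with its interval of definition \<open>J\<close>, which starts
  at \<open>0\<close> and is nondegenerate; values outside \<open>J\<close> are irrelevant. The last condition says that the
  derivative is continuous.\<close>

definition forward_solution ::
  "('a::real_normed_vector \<Rightarrow> 'a) \<Rightarrow> real set \<Rightarrow> (real \<Rightarrow> 'a) \<Rightarrow> bool" where
  "forward_solution F J x \<longleftrightarrow>
     is_interval J \<and> 0 \<in> J \<and> J \<subseteq> {0..} \<and> J \<noteq> {0} \<and>
     (\<forall>t\<in>J. (x has_vector_derivative F (x t)) (at t within J)) \<and>
     continuous_on J (\<lambda>t. F (x t))"

definition maximal_forward_solution ::
  "('a::real_normed_vector \<Rightarrow> 'a) \<Rightarrow> real set \<Rightarrow> (real \<Rightarrow> 'a) \<Rightarrow> bool" where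
  "maximal_forward_solution F J x \<longleftrightarrow>
     forward_solution F J x \<and>
     \<not> (\<exists>J' y. forward_solution F J' y \<and> J \<subset> J' \<and> (\<forall>t\<in>J. y t = x t))"

end

theory Submission
  imports Defs "HOL-Complex_Analysis.Great_Picard"
begin

text \<open>Since the dissipation inequality is affine in the unrestricted input, it forces
  \<open>V' x = 2 x\<close>; inserting \<open>u = 0\<close> gives \<open>x * f\<^sub>i x < 0\<close> outside a compact interval. The diffusive
  coupling at a node whose state has the largest modulus points towards the origin as well, so every
  sufficiently large cube is forward invariant, for every coupling gain. Global existence
  of the solutions, which stay in a compact set, is then a matter of Peano's existence theorem.\<close>

section \<open>Peano's existence theorem\<close>

text \<open>Gives all Picard iterates below the same Lipschitz constant \<open>M\<close>, whatever
  the delay. For \<open>t < 0\<close> the interval \<open>{0..t}\<close> is empty and the function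
  equals \<open>c\<close>, so the estimate extends to the whole line.\<close>

lemma lipschitz_on_indefinite_integral:
  fixes g :: "real \<Rightarrow> 'a::euclidean_space"
  assumes g: "continuous_on UNIV g" and M: "\<And>s. norm (g s) \<le> M"
  shows "M-lipschitz_on UNIV (\<lambda>t. c + integral {0..t} g)"
proof -
  have int: "g integrable_on {u..v}" for u v
    using g by (blast intro: integrable_continuous_real continuous_on_subset)
  have "0 \<le> M"
    using M[of 0] norm_ge_zero order_trans by blast
  have le: "norm (integral {0..t} g - integral {0..s} g) \<le> M * (t - s)" if "s \<le> t" for s t
  proof -
    have eq: "integral {0..t} g - integral {0..s} g = integral {max 0 s..t} g"
    proof (cases "0 \<le> s")
      case True
      then show ?thesis
        using Henstock_Kurzweil_Integration.integral_combine[of 0 s t g] that int by (simp add: algebra_simps)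
    next
      case False
      then show ?thesis by simp
    qed
    show ?thesis
    proof (cases "max 0 s \<le> t")
      case True
      have "norm (integral {max 0 s..t} g) \<le> M * (t - max 0 s)"
        using True g M by (intro integral_bound) (auto intro: continuous_on_subset)
      also have "\<dots> \<le> M * (t - s)"
        using \<open>0 \<le> M\<close> by (intro mult_left_mono) auto
      finally show ?thesis by (simp add: eq)
    next
      case False
      then show ?thesis using \<open>0 \<le> M\<close> that by (simp add: eq)
    qed
  qed
  show ?thesis
  proof (rule lipschitz_onI)
    show "dist (c + integral {0..s} g) (c + integral {0..t} g) \<le> M * dist s t" for s t
      using le[of s t] le[of t s]
      by (cases "s \<le> t") (auto simp: dist_norm norm_minus_commute abs_if)
  qed fact
qed

text \<open>Tonelli's construction: with a delay \<open>\<delta>\<close> in the integrand, Picard iteration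
  becomes stationary on \<open>{..k * \<delta>}\<close> after \<open>k\<close> steps. The integral vanishes for \<open>t < 0\<close>, which provides
  the constant initial history.\<close>

lemma delayed_integral_equation_solution:
  fixes G :: "'a::euclidean_space \<Rightarrow> 'a"
  assumes G: "continuous_on UNIV G" and M: "\<And>x. norm (G x) \<le> M"
  obtains y where "M-lipschitz_on UNIV y"
    and "\<And>t. t \<le> real k * \<delta> \<Longrightarrow> y t = c + integral {0..t} (\<lambda>s. G (y (s - \<delta>)))"
proof -
  define P where "P = (\<lambda>y t. c + integral {0..t} (\<lambda>s. G (y (s - \<delta>))))"
  define Y where "Y = (\<lambda>k. (P ^^ k) (\<lambda>_. c))"
  have Y_Suc: "Y (Suc k) = P (Y k)" for k
    by (simp add: Y_def)
  have "0 \<le> M"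
    using M norm_ge_zero order_trans by blast
  have lip: "M-lipschitz_on UNIV (Y k)" for k
  proof (induction k)
    case 0
    then show ?case using \<open>0 \<le> M\<close> by (simp add: Y_def lipschitz_on_def)
  next
    case (Suc k)
    have "continuous_on UNIV (\<lambda>s. G (Y k (s - \<delta>)))"
      by (intro continuous_on_compose2[OF G] continuous_on_compose2[OF lipschitz_on_continuous_on[OF Suc]]
          continuous_intros) auto
    then show ?case
      unfolding Y_Suc P_def by (rule lipschitz_on_indefinite_integral) (rule M)
  qed
  \<comment> \<open>For \<open>s\<close> up to \<open>real (Suc k) * \<delta>\<close> the delayed
    time \<open>s - \<delta>\<close> is at most \<open>real k * \<delta>\<close>, so the integrand
    only sees times at which the iterates already agree. The base case is \<open>t \<le> 0\<close>,
    where the integral is zero.\<close>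
  have stat: "Y (Suc k) t = Y k t" if "t \<le> real k * \<delta>" for k t
    using that
  proof (induction k arbitrary: t)
    case 0
    then show ?case by (auto simp: Y_def P_def)
  next
    case (Suc k)
    have "integral {0..t} (\<lambda>s. G (Y (Suc k) (s - \<delta>))) = integral {0..t} (\<lambda>s. G (Y k (s - \<delta>)))"
      using Suc.prems by (intro integral_cong) (auto simp: algebra_simps Suc.IH)
    then have "P (Y (Suc k)) t = P (Y k) t"
      by (simp add: P_def)
    then show ?case by (simp only: Y_Suc)
  qed
  show ?thesis
  proof (rule that)
    show "Y k t = c + integral {0..t} (\<lambda>s. G (Y k (s - \<delta>)))" if "t \<le> real k * \<delta>" for t
      using stat[OF that] by (simp add: Y_Suc P_def)
  qed (rule lip)
qed

text \<open>The solutions with delay \<open>h / (n + 1)\<close> are uniformly bounded and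
  equi-Lipschitz on \<open>{0..h}\<close>, so Arzela-Ascoli yields a uniformly convergent
  subsequence. The delay shifts its values by at most \<open>M\<close> times the delay, hence the
  limit solves the undelayed equation by dominated convergence.\<close>

lemma peano_integral_equation:
  fixes G :: "'a::euclidean_space \<Rightarrow> 'a" and h :: real
  assumes G: "continuous_on UNIV G" and M: "\<And>x. norm (G x) \<le> M" and "h > 0"
  obtains y where "continuous_on {0..h} y"
    and "\<And>t. t \<in> {0..h} \<Longrightarrow> y t = c + integral {0..t} (\<lambda>s. G (y s))"
proof -
  \<comment> \<open>\<open>Suc n\<close> delays cover exactly \<open>h\<close>, so
    \<open>Suc n\<close> iteration steps suffice on \<open>{..h}\<close>.\<close>
  define \<delta> where "\<delta> n = h / real (Suc n)" for n
  have \<delta>pos: "\<delta> n > 0" for n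
    using \<open>h > 0\<close> by (simp add: \<delta>_def)
  have \<delta>h: "real (Suc n) * \<delta> n = h" for n
    by (simp add: \<delta>_def)
  have \<delta>lim: "\<delta> \<longlonglongrightarrow> 0"
    unfolding \<delta>_def by (rule LIMSEQ_Suc[OF lim_const_over_n])
  have "\<exists>y. M-lipschitz_on UNIV y \<and> (\<forall>t\<le>h. y t = c + integral {0..t} (\<lambda>s. G (y (s - \<delta> n))))" for n
    using delayed_integral_equation_solution[OF G M, of "Suc n" "\<delta> n" c] by (metis \<delta>h)
  then obtain z where lip: "\<And>n. M-lipschitz_on UNIV (z n)"
    and z: "\<And>n t. t \<le> h \<Longrightarrow> z n t = c + integral {0..t} (\<lambda>s. G (z n (s - \<delta> n)))"
    by metis
  have "0 \<le> M"
    using M norm_ge_zero order_trans by blast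
  have z_dist: "norm (z n s - z n t) \<le> M * \<bar>s - t\<bar>" for n s t
    using lipschitz_onD[OF lip[of n], of s t] by (simp add: dist_norm)
  have z0: "z n 0 = c" for n
    using z[of 0 n] \<open>h > 0\<close> by simp
  obtain y k where y: "continuous_on {0..h} y" and k: "strict_mono (k :: nat \<Rightarrow> nat)"
    and unif: "\<And>e. 0 < e \<Longrightarrow> \<exists>N. \<forall>n t. n \<ge> N \<and> t \<in> {0..h} \<longrightarrow> norm (z (k n) t - y t) < e"
  proof (rule Arzela_Ascoli[of "{0..h}" z "norm c + M * h"])
    show "norm (z n t) \<le> norm c + M * h" if "t \<in> {0..h}" for n t
    proof -
      have "norm (z n t - c) \<le> M * h"
        using z_dist[of n t 0] that \<open>0 \<le> M\<close> z0[of n] mult_left_mono[of t h M] by auto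
      then show ?thesis
        using norm_triangle_sub[of "z n t" c] by linarith
    qed
    show "\<exists>d>0. \<forall>n s. s \<in> {0..h} \<and> norm (t - s) < d \<longrightarrow> norm (z n t - z n s) < e"
      if "t \<in> {0..h}" "e > 0" for t e
    proof (intro exI conjI allI impI)
      \<comment> \<open>\<open>M + 1\<close> replaces \<open>M\<close> because \<open>M\<close> may
        be zero.\<close>
      show "e / (M + 1) > 0"
        using \<open>e > 0\<close> \<open>0 \<le> M\<close> by simp
      fix n s assume "s \<in> {0..h} \<and> norm (t - s) < e / (M + 1)"
      then have "(M + 1) * \<bar>t - s\<bar> < e"
        using \<open>0 \<le> M\<close> by (simp add: field_simps)
      then show "norm (z n t - z n s) < e"
        using z_dist[of n t s] by (simp add: algebra_simps)
    qed
  qed auto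
  have lim: "(\<lambda>n. z (k n) t) \<longlonglongrightarrow> y t" if "t \<in> {0..h}" for t
    unfolding LIMSEQ_def dist_norm using unif that by meson
  have \<delta>k: "(\<lambda>n. \<delta> (k n)) \<longlonglongrightarrow> 0"
    using LIMSEQ_subseq_LIMSEQ[OF \<delta>lim k] by (simp add: o_def)
  have lim_delayed: "(\<lambda>n. z (k n) (t - \<delta> (k n))) \<longlonglongrightarrow> y t" if "t \<in> {0..h}" for t
  proof -
    have "(\<lambda>n. z (k n) (t - \<delta> (k n)) - z (k n) t) \<longlonglongrightarrow> 0"
    proof (rule Lim_null_comparison)
      show "\<forall>\<^sub>F n in sequentially. norm (z (k n) (t - \<delta> (k n)) - z (k n) t) \<le> M * \<delta> (k n)"
        using z_dist[of "k n" "t - \<delta> (k n)" t for n] \<delta>pos by (simp add: less_imp_le)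
      show "(\<lambda>n. M * \<delta> (k n)) \<longlonglongrightarrow> 0"
        using tendsto_mult_right_zero[OF \<delta>k] .
    qed
    from tendsto_add[OF this lim[OF that]] show ?thesis by simp
  qed
  have "y t = c + integral {0..t} (\<lambda>s. G (y s))" if t: "t \<in> {0..h}" for t
  proof -
    have "(\<lambda>n. integral {0..t} (\<lambda>s. G (z (k n) (s - \<delta> (k n))))) \<longlonglongrightarrow> integral {0..t} (\<lambda>s. G (y s))"
    proof (rule dominated_convergence(2)[where h = "\<lambda>_. M"])
      show "(\<lambda>s. G (z (k n) (s - \<delta> (k n)))) integrable_on {0..t}" for n
        by (intro integrable_continuous_real continuous_on_compose2[OF G]
            continuous_on_compose2[OF lipschitz_on_continuous_on[OF lip]] continuous_intros) auto
      show "(\<lambda>n. G (z (k n) (s - \<delta> (k n)))) \<longlonglongrightarrow> G (y s)" if "s \<in> {0..t}" for s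
        using that t by (intro continuous_on_tendsto_compose[OF G] lim_delayed) auto
    qed (auto intro: M)
    then have "(\<lambda>n. z (k n) t) \<longlonglongrightarrow> c + integral {0..t} (\<lambda>s. G (y s))"
      using t by (subst z) (auto intro!: tendsto_intros)
    with lim[OF t] show ?thesis by (rule LIMSEQ_unique)
  qed
  with y show ?thesis by (rule that)
qed

text \<open>The integrand \<open>F (y s)\<close> is continuous, so the fundamental theorem of
  calculus applies. Limits and gluing are handled in integral form; this is the way back to the
  differential equation, with one-sided derivatives at the endpoints.\<close>

lemma integral_equation_has_vector_derivative:
  fixes F :: "'a::euclidean_space \<Rightarrow> 'a"
  assumes F: "continuous_on UNIV F" and y: "continuous_on {0..b} y"
    and eq: "\<And>t. t \<in> {0..b} \<Longrightarrow> y t = c + integral {0..t} (\<lambda>s. F (y s))"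
    and t: "t \<in> {0..b}"
  shows "(y has_vector_derivative F (y t)) (at t within {0..b})"
proof -
  have "((\<lambda>u. integral {0..u} (\<lambda>s. F (y s))) has_vector_derivative F (y t)) (at t within {0..b})"
    by (intro integral_has_vector_derivative continuous_on_compose2[OF F y] t) auto
  from has_vector_derivative_add[OF has_vector_derivative_const[of c] this]
  have "((\<lambda>u. c + integral {0..u} (\<lambda>s. F (y s))) has_vector_derivative F (y t)) (at t within {0..b})"
    by simp
  then show ?thesis
    by (rule has_vector_derivative_transform[OF t, rotated]) (simp add: eq)
qed

text \<open>Composing \<open>F\<close> with the projection onto the closed unit ball around
  \<open>c\<close> makes it bounded and leaves it unchanged on that ball. A solution for the
  truncated field solves the original equation as long as it stays in the ball.\<close>

theorem peano_existence:
  fixes F :: "'a::euclidean_space \<Rightarrow> 'a"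
  assumes F: "continuous_on UNIV F"
  obtains h y where "h > 0" "continuous_on {0..h} y" "y 0 = c"
    and "\<And>t. t \<in> {0..h} \<Longrightarrow> (y has_vector_derivative F (y t)) (at t within {0..h})"
proof -
  define p where "p = closest_point (cball c (1::real))"
  have p: "continuous_on UNIV p" and p_in: "\<And>x. p x \<in> cball c 1"
    and p_id: "\<And>x. x \<in> cball c 1 \<Longrightarrow> p x = x"
    unfolding p_def
    by (auto intro: continuous_on_closest_point closest_point_in_set closest_point_self
        simp del: mem_cball)
  have "compact (F ` cball c 1)"
    by (intro compact_continuous_image continuous_on_subset[OF F]) auto
  then have "bounded (F ` cball c 1)"
    by (rule compact_imp_bounded)
  then obtain M where M: "M > 0" "\<And>x. x \<in> cball c 1 \<Longrightarrow> norm (F x) \<le> M"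
    unfolding bounded_pos by blast
  \<comment> \<open>At speed at most \<open>M\<close>, the solution travels at most distance 1 by
    time \<open>h\<close> and so cannot leave the ball.\<close>
  define h where "h = 1 / M"
  have "h > 0" using M by (simp add: h_def)
  have G: "continuous_on UNIV (\<lambda>x. F (p x))"
    by (rule continuous_on_compose2[OF F p]) auto
  have GM: "norm (F (p x)) \<le> M" for x
    using M p_in by blast
  obtain y where y: "continuous_on {0..h} y"
    and eq: "\<And>t. t \<in> {0..h} \<Longrightarrow> y t = c + integral {0..t} (\<lambda>s. F (p (y s)))"
    using peano_integral_equation[OF G GM \<open>h > 0\<close>] by blast
  have "p (y t) = y t" if t: "t \<in> {0..h}" for t
  proof (rule p_id)
    have "norm (integral {0..t} (\<lambda>s. F (p (y s)))) \<le> M * (t - 0)"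
      using t by (intro integral_bound continuous_on_compose2[OF G] continuous_on_subset[OF y] GM) auto
    also have "\<dots> \<le> 1"
      using t M by (simp add: h_def field_simps)
    finally show "y t \<in> cball c 1"
      by (simp add: eq[OF t] dist_norm)
  qed
  then have "integral {0..t} (\<lambda>s. F (p (y s))) = integral {0..t} (\<lambda>s. F (y s))" if "t \<in> {0..h}" for t
    using that by (intro integral_cong) auto
  then have "y t = c + integral {0..t} (\<lambda>s. F (y s))" if "t \<in> {0..h}" for t
    using eq[OF that] that by simp
  then have "(y has_vector_derivative F (y t)) (at t within {0..h})" if "t \<in> {0..h}" for t
    using integral_equation_has_vector_derivative[OF F y] that by blast
  moreover have "y 0 = c"
    using eq[of 0] \<open>h > 0\<close> by simp
  ultimately show ?thesis
    using that \<open>h > 0\<close> y by blast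
qed

section \<open>Bounded maximal solutions are global\<close>

text \<open>The fundamental theorem of calculus tolerates finitely many exceptional points for a
  continuous \<open>y\<close>, so the integral equation holds on all of \<open>{0..b}\<close> and
  gives back the derivative everywhere. This serves to glue two solutions without computing the
  derivative at the junction.\<close>

lemma has_vector_derivative_at_exceptional_points:
  fixes F :: "'a::euclidean_space \<Rightarrow> 'a"
  assumes F: "continuous_on UNIV F" and y: "continuous_on {0..b} y" and S: "finite S"
    and der: "\<And>t. t \<in> {0<..<b} - S \<Longrightarrow> (y has_vector_derivative F (y t)) (at t)"
    and t: "t \<in> {0..b}"
  shows "(y has_vector_derivative F (y t)) (at t within {0..b})"
proof (rule integral_equation_has_vector_derivative[OF F y _ t])
  fix t assume t: "t \<in> {0..b}"
  have "((\<lambda>s. F (y s)) has_integral (y t - y 0)) {0..t}"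
    using t by (intro fundamental_theorem_of_calculus_interior_strong[OF S] der
        continuous_on_subset[OF y]) auto
  then show "y t = y 0 + integral {0..t} (\<lambda>s. F (y s))"
    by (simp add: integral_unique)
qed

lemma forward_solution_continuous_on:
  "forward_solution F J x \<Longrightarrow> continuous_on J x"
  unfolding forward_solution_def continuous_on_eq_continuous_within
  using has_vector_derivative_continuous by blast

text \<open>If \<open>J\<close> were bounded, the bounded solution would have bounded velocity,
  hence be Lipschitz and extend continuously to \<open>Sup J\<close>. Restarting there by Peano's
  theorem gives a proper extension, against maximality.\<close>

lemma bounded_maximal_forward_solution_global:
  fixes F :: "'a::euclidean_space \<Rightarrow> 'a"
  assumes F: "continuous_on UNIV F" and max: "maximal_forward_solution F J x"
    and bdd: "bounded (x ` J)"
  shows "J = {0..}"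
proof (rule ccontr)
  assume "J \<noteq> {0..}"
  have sol: "forward_solution F J x"
    using max by (simp add: maximal_forward_solution_def)
  then have J: "is_interval J" "0 \<in> J" "J \<subseteq> {0..}" "J \<noteq> {0}"
    and der: "\<And>t. t \<in> J \<Longrightarrow> (x has_vector_derivative F (x t)) (at t within J)"
    by (auto simp: forward_solution_def)
  have J_mem: "s \<in> J" if "0 \<le> s" "s \<le> t" "t \<in> J" for s t
    using J that by (meson mem_is_interval_1_I)
  obtain u where u: "u \<ge> 0" "u \<notin> J"
    using \<open>J \<noteq> {0..}\<close> J by auto
  have bdd_J: "bdd_above J"
    using u J_mem by (meson bdd_aboveI linear)
  define T where "T = Sup J"
  have le_T: "t \<le> T" if "t \<in> J" for t
    using bdd_J that by (simp add: T_def cSup_upper)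
  have less_T: "t \<in> J" if "0 \<le> t" "t < T" for t
    using less_cSup_iff[of J t] bdd_J J that J_mem by (metis T_def empty_iff less_imp_le)
  obtain v where "v \<in> J" "v > 0"
    using J by force
  then have "T > 0"
    using le_T by fastforce

  obtain M where M: "M \<ge> 0" "\<And>t. t \<in> J \<Longrightarrow> norm (F (x t)) \<le> M"
  proof -
    have "compact (F ` closure (x ` J))"
      using bdd by (intro compact_continuous_image continuous_on_subset[OF F]) auto
    then have "bounded (F ` closure (x ` J))"
      by (rule compact_imp_bounded)
    then obtain M where M: "M > 0" "\<And>y. y \<in> closure (x ` J) \<Longrightarrow> norm (F y) \<le> M"
      unfolding bounded_pos by blast
    have "norm (F (x t)) \<le> M" if "t \<in> J" for t
      using M(2) closure_subset[of "x ` J"] that by blast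
    with M(1) show ?thesis
      using that[of M] by simp
  qed
  have "M-lipschitz_on J x"
  proof (rule bounded_derivative_imp_lipschitz)
    show "(x has_derivative (\<lambda>r. r *\<^sub>R F (x t))) (at t within J)" if "t \<in> J" for t
      using der[OF that] by (simp add: has_vector_derivative_def)
    show "onorm (\<lambda>r. r *\<^sub>R F (x t)) \<le> M" if "t \<in> J" for t
      using M(2)[OF that] by (simp add: onorm_scaleR_left onorm_id)
  qed (use J M is_interval_convex in auto)
  \<comment> \<open>Passing to the closure treats alike the cases where \<open>J\<close> contains
    its supremum \<open>T\<close> and where it does not.\<close>
  then obtain g where g: "M-lipschitz_on (closure J) g" and gx: "\<And>t. t \<in> J \<Longrightarrow> g t = x t"
    using lipschitz_extend_closure by metis
  have "{0..T} \<subseteq> closure J"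
    using closure_mono[of "{0..<T}" J] less_T \<open>T > 0\<close> by (auto simp: subset_iff)
  with g have g_cont: "continuous_on {0..T} g"
    using lipschitz_on_continuous_on continuous_on_subset by blast

  obtain h z where "h > 0" and z: "continuous_on {0..h} z" and z0: "z 0 = g T"
    and z_der: "\<And>t. t \<in> {0..h} \<Longrightarrow> (z has_vector_derivative F (z t)) (at t within {0..h})"
    using peano_existence[OF F] by blast
  define w where "w t = (if t \<le> T then g t else z (t - T))" for t
  have w_cont: "continuous_on {0..T + h} w"
  proof -
    have "{0..T + h} = {0..T} \<union> {T..T + h}"
      using \<open>T > 0\<close> \<open>h > 0\<close> by auto
    moreover have "continuous_on {T..T + h} (\<lambda>t. z (t - T))"
      by (intro continuous_on_compose2[OF z] continuous_intros) auto
    ultimately show ?thesis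
      unfolding w_def
      by (auto intro!: continuous_on_If g_cont simp: z0)
  qed
  \<comment> \<open>The junction \<open>T\<close> and the two endpoints are left out here; they are
    recovered from continuity of \<open>w\<close>.\<close>
  have w_der: "(w has_vector_derivative F (w t)) (at t)" if t: "t \<in> {0<..<T + h} - {T}" for t
  proof (cases "t < T")
    case True
    then have "{0<..<T} \<subseteq> J" "t \<in> {0<..<T}"
      using less_T t by auto
    then have "(x has_vector_derivative F (x t)) (at t)"
      using der[of t] has_vector_derivative_within_subset[of x "F (x t)" t J "{0<..<T}"]
      by (auto simp: at_within_open[of t "{0<..<T}"])
    moreover have "w s = x s" if "s \<in> {0<..<T}" for s
      using that \<open>{0<..<T} \<subseteq> J\<close> gx by (auto simp: w_def)
    ultimately show ?thesis
      using has_vector_derivative_transform_within_open[of x "F (x t)" t "{0<..<T}" w] \<open>t \<in> {0<..<T}\<close>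
      by auto
  next
    case False
    then have t: "t - T \<in> {0<..<h}" "t \<in> {T<..<T + h}"
      using that by auto
    have "(z has_vector_derivative F (z (t - T))) (at (t - T))"
      using z_der[of "t - T"] t at_within_Icc_at[of 0 "t - T" h] by simp
    moreover have "((\<lambda>t. t - T) has_vector_derivative 1) (at t)"
      using has_vector_derivative_diff[OF has_vector_derivative_id has_vector_derivative_const, of T "at t"] by simp
    ultimately have "((\<lambda>t. z (t - T)) has_vector_derivative F (z (t - T))) (at t)"
      using vector_diff_chain_at[of "\<lambda>t. t - T" 1 t z] by (simp add: o_def)
    then show ?thesis
      using has_vector_derivative_transform_within_open[of "\<lambda>t. z (t - T)" "F (z (t - T))" t "{T<..<T + h}" w] t
      by (auto simp: w_def)
  qed
  have "(w has_vector_derivative F (w t)) (at t within {0..T + h})" if "t \<in> {0..T + h}" for t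
    by (rule has_vector_derivative_at_exceptional_points[OF F w_cont _ w_der that, of "{T}"]) auto
  moreover have "continuous_on {0..T + h} (\<lambda>t. F (w t))"
    by (rule continuous_on_compose2[OF F w_cont]) simp
  ultimately have "forward_solution F {0..T + h} w"
    using \<open>T > 0\<close> \<open>h > 0\<close> by (auto simp: forward_solution_def is_interval_cc)
  moreover have "J \<subset> {0..T + h}"
  proof -
    have "T + h \<in> {0..T + h} - J"
      using \<open>T > 0\<close> \<open>h > 0\<close> le_T[of "T + h"] by auto
    moreover have "J \<subseteq> {0..T + h}"
    proof
      fix t assume "t \<in> J"
      then show "t \<in> {0..T + h}"
        using J(3) le_T[of t] \<open>h > 0\<close> by auto
    qed
    ultimately show ?thesis by blast
  qed
  moreover have "\<forall>t\<in>J. w t = x t"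
    using le_T gx by (simp add: w_def)
  ultimately show False
    using max unfolding maximal_forward_solution_def by blast
qed

section \<open>Invariant cubes\<close>

lemma state_strictly_semi_passive_inward:
  assumes "state_strictly_semi_passive f"
  obtains \<rho> where "\<And>x. \<bar>x\<bar> \<ge> \<rho> \<Longrightarrow> x * f x < 0"
proof -
  obtain V \<rho> H \<psi> where "\<rho> > 0" and \<psi>: "\<forall>s\<ge>0. \<psi> s > (0::real)"
    and diss: "\<And>x u. deriv V x * (f x + u) \<le> 2 * u * x - H x"
    and H: "\<And>x. \<bar>x\<bar> \<ge> \<rho> \<Longrightarrow> H x \<ge> \<psi> \<bar>x\<bar>"
    using assms unfolding state_strictly_semi_passive_def by blast
  have V': "deriv V x = 2 * x" for x
  proof (rule ccontr)
    assume "deriv V x \<noteq> 2 * x"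
    \<comment> \<open>This input makes the left side of the dissipation inequality exceed the right
      side by exactly 1.\<close>
    define u where "u = (1 - H x - deriv V x * f x) / (deriv V x - 2 * x)"
    have "(deriv V x - 2 * x) * u = 1 - H x - deriv V x * f x"
      using \<open>deriv V x \<noteq> 2 * x\<close> by (simp add: u_def)
    then show False
      using diss[of x u] by (simp add: algebra_simps)
  qed
  have "x * f x < 0" if "\<bar>x\<bar> \<ge> \<rho>" for x
    using diss[of x 0] H[OF that] \<psi>[rule_format, of "\<bar>x\<bar>"] V'[of x] by simp
  then show ?thesis by (rule that)
qed

lemma infnorm_attained_cart:
  fixes x :: "real ^ 'n"
  obtains i where "infnorm x = \<bar>x $ i\<bar>"
proof -
  have "infnorm x \<in> (\<lambda>i. \<bar>x \<bullet> i\<bar>) ` Basis"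
    unfolding infnorm_Max by (rule Max_in) auto
  then show ?thesis
    using that by (auto simp: Basis_vec_def inner_axis)
qed

text \<open>When \<open>x $ i\<close> has the largest modulus, each
  \<open>x $ i * (x $ i - x $ j)\<close> is nonnegative, so the coupling can only help the drift
  towards the origin, whatever the gain. This is the source of the uniformity in
  \<open>\<gamma>\<close>. The product with \<open>x $ i\<close> covers both signs at once.\<close>

lemma network_field_inward:
  fixes x :: "real ^ 'n::finite"
  assumes "\<And>j. a i j \<ge> 0" "\<gamma> \<ge> 0" "x $ i * f i (x $ i) < 0" "\<And>j. \<bar>x $ j\<bar> \<le> \<bar>x $ i\<bar>"
  shows "x $ i * network_field f a \<gamma> x $ i < 0"
proof -
  have "0 \<le> a i j * (x $ i * (x $ i - x $ j))" for j
  proof -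
    have "x $ i * x $ j \<le> \<bar>x $ i\<bar> * \<bar>x $ j\<bar>"
      by (simp flip: abs_mult)
    also have "\<dots> \<le> \<bar>x $ i\<bar> * \<bar>x $ i\<bar>"
      using assms by (intro mult_left_mono) auto
    finally have "0 \<le> x $ i * (x $ i - x $ j)"
      by (simp add: algebra_simps)
    then show ?thesis
      using assms(1) by simp
  qed
  then have "0 \<le> \<gamma> * (\<Sum>j\<in>UNIV. a i j * (x $ i * (x $ i - x $ j)))"
    using \<open>\<gamma> \<ge> 0\<close> by (simp add: sum_nonneg)
  also have "\<dots> = x $ i * (\<gamma> * (\<Sum>j\<in>UNIV. a i j * (x $ i - x $ j)))"
    by (simp add: sum_distrib_left algebra_simps)
  finally show ?thesis
    using assms by (simp add: network_field_def right_diff_distrib)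
qed

text \<open>Consider a time in \<open>{0..t}\<close> at which \<open>infnorm\<close> is largest, and
  a coordinate attaining it there. If the maximum exceeded \<open>M\<close>, the square of that
  coordinate would have negative derivative, so it would have been larger just before. Working with
  one coordinate avoids differentiating the nonsmooth \<open>infnorm\<close>.\<close>

lemma network_solution_infnorm_le:
  fixes f :: "'n::finite \<Rightarrow> real \<Rightarrow> real"
  assumes "\<And>i j. a i j \<ge> 0" "\<gamma> \<ge> 0"
    and inward: "\<And>i s. \<bar>s\<bar> > M \<Longrightarrow> s * f i s < 0"
    and sol: "forward_solution (network_field f a \<gamma>) J x"
    and init: "infnorm (x 0) \<le> M" and "t \<in> J"
  shows "infnorm (x t) \<le> M"
proof (rule ccontr)
  assume *: "\<not> infnorm (x t) \<le> M"
  have J: "is_interval J" "0 \<in> J" "J \<subseteq> {0..}"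
    and der: "\<And>t. t \<in> J \<Longrightarrow> (x has_vector_derivative network_field f a \<gamma> (x t)) (at t within J)"
    using sol by (auto simp: forward_solution_def)
  have sub: "{0..t} \<subseteq> J" and "t \<ge> 0"
    using J \<open>t \<in> J\<close> mem_is_interval_1_I[OF J(1,2) \<open>t \<in> J\<close>] by auto
  have "continuous_on {0..t} (\<lambda>s. infnorm (x s))"
    using continuous_on_subset[OF forward_solution_continuous_on[OF sol] sub]
    unfolding continuous_on_def by (simp add: tendsto_infnorm)
  then obtain \<tau> where \<tau>: "\<tau> \<in> {0..t}" and max: "\<And>s. s \<in> {0..t} \<Longrightarrow> infnorm (x s) \<le> infnorm (x \<tau>)"
    using continuous_attains_sup[of "{0..t}" "\<lambda>s. infnorm (x s)"] \<open>t \<ge> 0\<close> by auto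
  have "infnorm (x \<tau>) > M"
    using max[of t] * \<open>t \<ge> 0\<close> by auto
  \<comment> \<open>The initial value lies in the cube; a positive \<open>\<tau>\<close> leaves room
    to step back in time.\<close>
  then have "\<tau> > 0"
    using init \<tau> by (cases "\<tau> = 0") auto
  obtain i where i: "infnorm (x \<tau>) = \<bar>x \<tau> $ i\<bar>"
    by (rule infnorm_attained_cart)
  let ?l = "x \<tau> $ i * network_field f a \<gamma> (x \<tau>) $ i"
  have neg: "?l < 0"
  proof (rule network_field_inward[OF assms(1,2)])
    show "x \<tau> $ i * f i (x \<tau> $ i) < 0"
      using \<open>infnorm (x \<tau>) > M\<close> i by (intro inward) simp
    show "\<bar>x \<tau> $ j\<bar> \<le> \<bar>x \<tau> $ i\<bar>" for j
      unfolding i[symmetric] by (rule component_le_infnorm_cart)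
  qed
  have "\<tau> \<in> J"
    using \<tau> sub by blast
  then have "(x has_vector_derivative network_field f a \<gamma> (x \<tau>)) (at \<tau> within {0..t})"
    by (rule has_vector_derivative_within_subset[OF der sub])
  then have "((\<lambda>s. x s $ i) has_real_derivative network_field f a \<gamma> (x \<tau>) $ i) (at \<tau> within {0..t})"
    unfolding has_real_derivative_iff_has_vector_derivative
    by (rule bounded_linear.has_vector_derivative[OF bounded_linear_vec_nth])
  from DERIV_power[OF this, of 2]
  have "((\<lambda>s. (x s $ i)\<^sup>2) has_real_derivative 2 * ?l) (at \<tau> within {0..t})"
    by (simp add: algebra_simps)
  then obtain d where "d > 0"
    and d: "\<And>h. h > 0 \<Longrightarrow> \<tau> - h \<in> {0..t} \<Longrightarrow> h < d \<Longrightarrow> (x \<tau> $ i)\<^sup>2 < (x (\<tau> - h) $ i)\<^sup>2"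
    using has_real_derivative_neg_dec_left neg by (metis mult_pos_neg zero_less_numeral)
  \<comment> \<open>The bound by \<open>\<tau>\<close> keeps \<open>\<tau> - h\<close> nonnegative,
    and halving \<open>d\<close> gives the strict \<open>h < d\<close>.\<close>
  define h where "h = min \<tau> (d / 2)"
  have h: "h > 0" "\<tau> - h \<in> {0..t}" "h < d"
    using \<open>\<tau> > 0\<close> \<open>d > 0\<close> \<tau> by (auto simp: h_def)
  have "\<bar>x \<tau> $ i\<bar> < \<bar>x (\<tau> - h) $ i\<bar>"
    using d[OF h] by (auto simp: not_le[symmetric] abs_le_square_iff)
  also have "\<dots> \<le> infnorm (x (\<tau> - h))"
    by (rule component_le_infnorm_cart)
  finally show False
    using max[OF h(2)] i by simp
qed

lemma continuous_on_network_field: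
  assumes "\<And>i. continuous_on UNIV (f i)"
  shows "continuous_on UNIV (network_field f a \<gamma>)"
  unfolding network_field_def
  by (intro continuous_intros continuous_on_compose2[OF assms]) auto

theorem corollary1:
  fixes f :: "'n::finite \<Rightarrow> real \<Rightarrow> real"
    and a :: "'n \<Rightarrow> 'n \<Rightarrow> real"
  assumes "\<And>i. continuous_on UNIV (f i)"
    and "\<And>i j. a i j \<ge> 0"
    and "Digraph_Component.connected (interconnection_graph a)"
    and "has_directed_spanning_tree (interconnection_graph a)"
    and "\<And>i. state_strictly_semi_passive (f i)"
  shows "\<forall>r\<^sub>o>0. \<forall>\<gamma>\<^sub>o>0. \<exists>R\<ge>r\<^sub>o. \<forall>\<gamma>\<ge>\<gamma>\<^sub>o. \<forall>J x.
           maximal_forward_solution (network_field f a \<gamma>) J x \<and> norm (x 0) \<le> r\<^sub>o \<longrightarrow>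
             J = {0..} \<and> (\<forall>t\<ge>0. norm (x t) \<le> R)"
proof (intro allI impI)
  fix r\<^sub>o \<gamma>\<^sub>o :: real
  assume "r\<^sub>o > 0" "\<gamma>\<^sub>o > 0"
  have "\<exists>\<rho>. \<forall>s. \<bar>s\<bar> \<ge> \<rho> \<longrightarrow> s * f i s < 0" for i
    using state_strictly_semi_passive_inward[OF assms(5)] by metis
  then obtain \<rho> where \<rho>: "\<And>i s. \<bar>s\<bar> \<ge> \<rho> i \<Longrightarrow> s * f i s < 0"
    by metis
  \<comment> \<open>The half side of the invariant cube: large enough to contain the initial ball
    and for every \<open>f i\<close> to point inward beyond it. The gain does not enter.\<close>
  define M where "M = max r\<^sub>o (Max (range \<rho>))"
  have "\<rho> i \<le> M" for i
    by (simp add: M_def le_max_iff_disj)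
  then have inward: "s * f i s < 0" if "\<bar>s\<bar> > M" for i s
    using \<rho> that by (meson less_imp_le order_trans)
  \<comment> \<open>The factor comes from bounding the Euclidean norm by \<open>infnorm\<close>; it
    is at least 1 since the index type is nonempty.\<close>
  define R where "R = sqrt CARD('n) * M"
  have "r\<^sub>o \<le> M"
    by (simp add: M_def)
  also have "M \<le> R"
    using \<open>r\<^sub>o > 0\<close> \<open>r\<^sub>o \<le> M\<close> mult_right_mono[of 1 "sqrt CARD('n)" M] by (simp add: R_def Suc_leI)
  finally have "r\<^sub>o \<le> R" .
  moreover have "J = {0..} \<and> (\<forall>t\<ge>0. norm (x t) \<le> R)"
    if "\<gamma> \<ge> \<gamma>\<^sub>o" and max: "maximal_forward_solution (network_field f a \<gamma>) J x" and "norm (x 0) \<le> r\<^sub>o"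
    for \<gamma> J x
  proof -
    have sol: "forward_solution (network_field f a \<gamma>) J x"
      using max by (simp add: maximal_forward_solution_def)
    \<comment> \<open>The bound is established on \<open>J\<close> first, since it is what forces
      \<open>J\<close> to be the whole half-line.\<close>
    have bound: "norm (x t) \<le> R" if "t \<in> J" for t
    proof -
      have "infnorm (x 0) \<le> M"
        using infnorm_le_norm[of "x 0"] \<open>norm (x 0) \<le> r\<^sub>o\<close> \<open>r\<^sub>o \<le> M\<close> by linarith
      then have "infnorm (x t) \<le> M"
        using network_solution_infnorm_le[OF assms(2) _ inward sol _ that] \<open>\<gamma>\<^sub>o > 0\<close> \<open>\<gamma> \<ge> \<gamma>\<^sub>o\<close> by auto
      then have "sqrt CARD('n) * infnorm (x t) \<le> R"
        unfolding R_def by (intro mult_left_mono) auto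
      then show ?thesis
        using norm_le_infnorm[of "x t"] by simp
    qed
    then have "bounded (x ` J)"
      by (auto simp: bounded_iff)
    then have "J = {0..}"
      by (rule bounded_maximal_forward_solution_global[OF continuous_on_network_field[OF assms(1)] max])
    with bound show ?thesis by simp
  qed
  ultimately show "\<exists>R\<ge>r\<^sub>o. \<forall>\<gamma>\<ge>\<gamma>\<^sub>o. \<forall>J x.
           maximal_forward_solution (network_field f a \<gamma>) J x \<and> norm (x 0) \<le> r\<^sub>o \<longrightarrow>
             J = {0..} \<and> (\<forall>t\<ge>0. norm (x t) \<le> R)"
    by blast
qed

end
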